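(* Let $x$ be a linear frequency modulation (LFM) signal $$x(t)=A(t)e^{i2\pi\phi(t)}=A\,e^{pt+\frac q2 t^2}\,e^{i2\pi(ct+\frac12 r t^2)},$$ with phase $\phi(t)=ct+\frac12 rt^2$, instantaneous frequency (IF) $\phi'(t)=c+rt$, chirp rate $\phi''(t)=r$ and instantaneous amplitude $A(t)=Ae^{pt+\frac q2t^2}$, where $p,q$ are real numbers, $c$ is positive, and $|p|$ and $|q|$ are much smaller than $c$. Let $\widetilde W_x$, $\widetilde W_x^{g_1}$ and $\omega_x^{2adp}$ be as defined in the context. Then at every $(a,b)$ where $$\frac{\partial}{\partial a}\Big(a\,\frac{\widetilde W_x^{g_1}(a,b)}{\widetilde W_x(a,b)}\Big)\neq 0\quad\text{and}\quad \widetilde W_x(a,b)\neq 0,$$ the quantity $\omega_x^{2adp}(a,b)$ is the IF of $x$, namely $$\omega_x^{2adp}(a,b)=c+rb .$$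
   Context: Let $\mu>0$, let $g\in L_2(\mathbb{R})$ be a window function with a certain decaying order as $t\to\infty$, and let $\sigma=\sigma(b)$ be a positive function of the time variable $b$ ($g'$ and $\sigma'$ denote derivatives). Signals are assumed to be slowly growing (a function $x$ is slowly growing if $x(t)/(1+|t|^L)$ is bounded on $(-\infty,\infty)$ for some nonnegative integer $L$), and $g$ is assumed to decay to $0$ fast enough that the transforms below are well defined. For scale $a>0$ and time $b\in\mathbb{R}$, the adaptive continuous wavelet transform (CWT with time-varying parameter $\sigma(b)$) of $x$ is $$\widetilde W_x(a,b)=\int_{-\infty}^{\infty}x(b+at)\,\frac1{\sigma(b)}\,g\Big(\frac t{\sigma(b)}\Big)e^{-i2\pi\mu t}\,dt .$$ With $g_1(t)=t\,g(t)$ and $g_2(t)=t\,g'(t)$, the functions $\widetilde W_x^{g_1}$ and $\widetilde W_x^{g_2}$ are given by the same formula with $g$ replaced by $g_1$ and $g_2$ respectively, that is, $$\widetilde W_x^{g_1}(a,b)=\int_{-\infty}^\infty x(b+at)\frac{t}{\sigma(b)^2}g\Big(\frac t{\sigma(b)}\Big)e^{-i2\pi\mu t}dt,\qquad \widetilde W_x^{g_2}(a,b)=\int_{-\infty}^\infty x(b+at)\frac{t}{\sigma(b)^2}g'\Big(\frac t{\sigma(b)}\Big)e^{-i2\pi\mu t}dt.$$ Put $$R_0(a,b)=\frac{1}{\frac{\partial}{\partial a}\Big(a\frac{\widetilde W_x^{g_1}(a,b)}{\widetilde W_x(a,b)}\Big)}\left\{\frac{\partial}{\partial a}\Big(\frac{\frac{\partial}{\partial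 b}\widetilde W_x(a,b)}{\widetilde W_x(a,b)}\Big)+\frac{\sigma'(b)}{\sigma(b)}\,\frac{\partial}{\partial a}\Big(\frac{\widetilde W_x^{g_2}(a,b)}{\widetilde W_x(a,b)}\Big)\right\}.$$ The second-order adaptive phase transformation $\omega_x^{2adp}$ is defined as follows. If $\widetilde W_x(a,b)\ne0$ and $\frac{\partial}{\partial a}\big(a\,\widetilde W_x^{g_1}(a,b)/\widetilde W_x(a,b)\big)\ne0$, then $$\omega_x^{2adp}(a,b)=\mathrm{Re}\Big\{\frac{\frac{\partial}{\partial b}\widetilde W_x(a,b)}{i2\pi\,\widetilde W_x(a,b)}\Big\}+\frac{\sigma'(b)}{\sigma(b)}\,\mathrm{Re}\Big\{\frac{\widetilde W_x^{g_2}(a,b)}{i2\pi\,\widetilde W_x(a,b)}\Big\}-a\,\mathrm{Re}\Big\{\frac{\widetilde W_x^{g_1}(a,b)}{i2\pi\,\widetilde W_x(a,b)}\,R_0(a,b)\Big\};$$ if $\widetilde W_x(a,b)\ne0$ and $\frac{\partial}{\partial a}\big(a\,\widetilde W_x^{g_1}(a,b)/\widetilde W_x(a,b)\big)=0$, then $\omega_x^{2adp}(a,b)$ is given by the first two terms only. *)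

theory Defs
  imports "HOL-Analysis.Analysis"
begin

text \<open>
  All partial derivatives below are derivatives of complex-valued functions of one real variable
  and hence written with \<^const>\<open>vector_derivative\<close>. This is an arbitrary value where the derivative
  does not exist, so existence has to be required separately where it matters.
\<close>

definition adp_cwt_integrand ::
  "real \<Rightarrow> (real \<Rightarrow> real) \<Rightarrow> (real \<Rightarrow> complex) \<Rightarrow> (real \<Rightarrow> complex) \<Rightarrow> real \<Rightarrow> real \<Rightarrow> real \<Rightarrow> complex"
  where "adp_cwt_integrand \<mu> \<sigma> g x a b t =
    x (b + a * t) * complex_of_real (1 / \<sigma> b) * g (t / \<sigma> b)
      * exp (- (\<i> * complex_of_real (2 * pi * \<mu> * t)))"

definition adp_cwt_exists ::
  "real \<Rightarrow> (real \<Rightarrow> real) \<Rightarrow> (real \<Rightarrow> complex) \<Rightarrow> (real \<Rightarrow> complex) \<Rightarrow> real \<Rightarrow> real \<Rightarrow> bool"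
  where "adp_cwt_exists \<mu> \<sigma> g x a b \<longleftrightarrow> integrable lborel (adp_cwt_integrand \<mu> \<sigma> g x a b)"

definition adp_cwt ::
  "real \<Rightarrow> (real \<Rightarrow> real) \<Rightarrow> (real \<Rightarrow> complex) \<Rightarrow> (real \<Rightarrow> complex) \<Rightarrow> real \<Rightarrow> real \<Rightarrow> complex"
  where "adp_cwt \<mu> \<sigma> g x a b = integral\<^sup>L lborel (adp_cwt_integrand \<mu> \<sigma> g x a b)"

definition win1 :: "(real \<Rightarrow> complex) \<Rightarrow> real \<Rightarrow> complex"
  where "win1 g t = complex_of_real t * g t"

definition win2 :: "(real \<Rightarrow> complex) \<Rightarrow> real \<Rightarrow> complex"
  where "win2 g t = complex_of_real t * vector_derivative g (at t)"

text \<open>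
  Membership in \<open>L\<^sub>2\<close>, decay to 0, and existence of the derivative used by \<^const>\<open>win2\<close>. The rate
  of decay depends on the signal: it is required through \<^const>\<open>adp_cwt_exists\<close>.
\<close>
definition window :: "(real \<Rightarrow> complex) \<Rightarrow> bool"
  where "window g \<longleftrightarrow>
    g \<in> borel_measurable lborel \<and> integrable lborel (\<lambda>t. (cmod (g t))\<^sup>2) \<and>
    (g \<longlongrightarrow> 0) at_infinity \<and> (\<forall>t. g differentiable (at t))"

definition adp_cwt_db ::
  "real \<Rightarrow> (real \<Rightarrow> real) \<Rightarrow> (real \<Rightarrow> complex) \<Rightarrow> (real \<Rightarrow> complex) \<Rightarrow> real \<Rightarrow> real \<Rightarrow> complex"
  where "adp_cwt_db \<mu> \<sigma> g x a b = vector_derivative (\<lambda>b'. adp_cwt \<mu> \<sigma> g x a b') (at b)"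

definition ratio1 ::
  "real \<Rightarrow> (real \<Rightarrow> real) \<Rightarrow> (real \<Rightarrow> complex) \<Rightarrow> (real \<Rightarrow> complex) \<Rightarrow> real \<Rightarrow> real \<Rightarrow> complex"
  where "ratio1 \<mu> \<sigma> g x a b = adp_cwt \<mu> \<sigma> (win1 g) x a b / adp_cwt \<mu> \<sigma> g x a b"

definition ratio2 ::
  "real \<Rightarrow> (real \<Rightarrow> real) \<Rightarrow> (real \<Rightarrow> complex) \<Rightarrow> (real \<Rightarrow> complex) \<Rightarrow> real \<Rightarrow> real \<Rightarrow> complex"
  where "ratio2 \<mu> \<sigma> g x a b = adp_cwt \<mu> \<sigma> (win2 g) x a b / adp_cwt \<mu> \<sigma> g x a b"

definition ratio_db ::
  "real \<Rightarrow> (real \<Rightarrow> real) \<Rightarrow> (real \<Rightarrow> complex) \<Rightarrow> (real \<Rightarrow> complex) \<Rightarrow> real \<Rightarrow> real \<Rightarrow> complex"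
  where "ratio_db \<mu> \<sigma> g x a b = adp_cwt_db \<mu> \<sigma> g x a b / adp_cwt \<mu> \<sigma> g x a b"

definition R0_denom ::
  "real \<Rightarrow> (real \<Rightarrow> real) \<Rightarrow> (real \<Rightarrow> complex) \<Rightarrow> (real \<Rightarrow> complex) \<Rightarrow> real \<Rightarrow> real \<Rightarrow> complex"
  where "R0_denom \<mu> \<sigma> g x a b =
    vector_derivative (\<lambda>a'. complex_of_real a' * ratio1 \<mu> \<sigma> g x a' b) (at a)"

definition R0 ::
  "real \<Rightarrow> (real \<Rightarrow> real) \<Rightarrow> (real \<Rightarrow> complex) \<Rightarrow> (real \<Rightarrow> complex) \<Rightarrow> real \<Rightarrow> real \<Rightarrow> complex"
  where "R0 \<mu> \<sigma> g x a b =
    1 / R0_denom \<mu> \<sigma> g x a b *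
    (vector_derivative (\<lambda>a'. ratio_db \<mu> \<sigma> g x a' b) (at a)
     + complex_of_real (deriv \<sigma> b / \<sigma> b) * vector_derivative (\<lambda>a'. ratio2 \<mu> \<sigma> g x a' b) (at a))"

text \<open>The phase transformation is left unspecified where the transform of the signal vanishes.\<close>
definition omega_2adp ::
  "real \<Rightarrow> (real \<Rightarrow> real) \<Rightarrow> (real \<Rightarrow> complex) \<Rightarrow> (real \<Rightarrow> complex) \<Rightarrow> real \<Rightarrow> real \<Rightarrow> real"
  where "omega_2adp \<mu> \<sigma> g x a b =
    (if adp_cwt \<mu> \<sigma> g x a b = 0 then undefined
     else if R0_denom \<mu> \<sigma> g x a b \<noteq> 0 then
       Re (adp_cwt_db \<mu> \<sigma> g x a b / (\<i> * 2 * pi * adp_cwt \<mu> \<sigma> g x a b))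
       + deriv \<sigma> b / \<sigma> b
           * Re (adp_cwt \<mu> \<sigma> (win2 g) x a b / (\<i> * 2 * pi * adp_cwt \<mu> \<sigma> g x a b))
       - a * Re (adp_cwt \<mu> \<sigma> (win1 g) x a b / (\<i> * 2 * pi * adp_cwt \<mu> \<sigma> g x a b)
           * R0 \<mu> \<sigma> g x a b)
     else
       Re (adp_cwt_db \<mu> \<sigma> g x a b / (\<i> * 2 * pi * adp_cwt \<mu> \<sigma> g x a b))
       + deriv \<sigma> b / \<sigma> b
           * Re (adp_cwt \<mu> \<sigma> (win2 g) x a b / (\<i> * 2 * pi * adp_cwt \<mu> \<sigma> g x a b)))"

definition lfm_phase :: "real \<Rightarrow> real \<Rightarrow> real \<Rightarrow> real"
  where "lfm_phase c r t = c * t + r * t\<^sup>2 / 2"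

definition lfm_amplitude :: "real \<Rightarrow> real \<Rightarrow> real \<Rightarrow> real \<Rightarrow> real"
  where "lfm_amplitude A p q t = A * exp (p * t + q * t\<^sup>2 / 2)"

definition lfm_signal :: "real \<Rightarrow> real \<Rightarrow> real \<Rightarrow> real \<Rightarrow> real \<Rightarrow> real \<Rightarrow> complex"
  where "lfm_signal A p q c r t =
    complex_of_real (lfm_amplitude A p q t) * exp (\<i> * complex_of_real (2 * pi * lfm_phase c r t))"

end

theory Submission
  imports Defs
begin

text \<open>
  Write \<open>P = p + 2 \<pi> \<i> c\<close> and \<open>Q = q + 2 \<pi> \<i> r\<close>, so that the signal satisfies \<open>x' = (P + Q t) x\<close>.
  Differentiating the transform in \<open>b\<close> gives
  \<open>\<partial>\<^sub>b W = (P + Q b) W + a \<sigma> Q W1 - (\<sigma>' / \<sigma>) (W + W2)\<close>, where \<open>W1\<close>, \<open>W2\<close> are the transforms for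
  the windows \<open>t g\<close> and \<open>t g'\<close>. Dividing by \<open>W\<close> and differentiating in \<open>a\<close> yields \<open>R0 = \<sigma> Q\<close>, so the
  phase transformation is the real part of \<open>(P + Q b - \<sigma>' / \<sigma>) / (2 \<pi> \<i>)\<close>, that is \<open>c + r b\<close>.

  The analytic work is to differentiate under the integral when nothing but the integrability of
  the three transforms near \<open>(a, b)\<close> is known: the modulus of the signal is a Gaussian in \<open>t\<close>, and a
  Gaussian factor is dominated near a point of parameter space by finitely many neighbouring ones.
\<close>

section \<open>Integrals under dilation\<close>

text \<open>Convergence along \<open>at s0\<close> can be tested on sequences, so dominated
  convergence for sequences suffices. As the bound holds only near \<open>s0\<close>, each sequence
  is first shifted past the terms that violate it.\<close>

lemma tendsto_integral_at:
  fixes f :: "real \<Rightarrow> real \<Rightarrow> complex"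
  assumes meas: "\<And>s. f s \<in> borel_measurable M" "f0 \<in> borel_measurable M"
    and w: "integrable M w"
    and bound: "\<forall>\<^sub>F s in at s0. \<forall>u. norm (f s u) \<le> w u"
    and lim: "\<And>u. ((\<lambda>s. f s u) \<longlongrightarrow> f0 u) (at s0)"
  shows "((\<lambda>s. \<integral>u. f s u \<partial>M) \<longlongrightarrow> (\<integral>u. f0 u \<partial>M)) (at s0)"
  unfolding tendsto_at_iff_sequentially
proof (intro allI impI)
  fix X :: "nat \<Rightarrow> real"
  assume X: "\<forall>i. X i \<in> UNIV - {s0}" "X \<longlonglongrightarrow> s0"
  then have fl: "filterlim X (at s0) sequentially"
    by (simp add: filterlim_at)
  from eventually_compose_filterlim[OF bound fl]
  obtain N where N: "\<And>n u. n \<ge> N \<Longrightarrow> norm (f (X n) u) \<le> w u"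
    by (auto simp: eventually_sequentially)
  have "(\<lambda>n. \<integral>u. f (X (n + N)) u \<partial>M) \<longlonglongrightarrow> (\<integral>u. f0 u \<partial>M)"
  proof (rule integral_dominated_convergence[where w = w])
    have "(\<lambda>n. f (X n) u) \<longlonglongrightarrow> f0 u" for u
      using filterlim_compose[OF lim fl] .
    then show "AE u in M. (\<lambda>n. f (X (n + N)) u) \<longlonglongrightarrow> f0 u"
      by (intro always_eventually allI LIMSEQ_ignore_initial_segment)
  qed (use meas w N in auto)
  then show "((\<lambda>s. \<integral>u. f s u \<partial>M) \<circ> X) \<longlonglongrightarrow> (\<integral>u. f0 u \<partial>M)"
    unfolding comp_def by (rule LIMSEQ_offset)
qed

lemma integral_dilate:
  fixes k g :: "real \<Rightarrow> complex"
  assumes "s > 0"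
  shows "(\<integral>t. k t * g (t / s) \<partial>lborel) = s * (\<integral>u. k (s * u) * g u \<partial>lborel)"
  using assms lborel_integral_real_affine[of s "\<lambda>t. k t * g (t / s)" 0]
  by (simp add: scaleR_conv_of_real)

lemma integrable_dilate_iff:
  fixes k g :: "real \<Rightarrow> 'a::{real_normed_algebra,banach,second_countable_topology}"
  assumes "s > 0"
  shows "integrable lborel (\<lambda>t. k t * g (t / s)) \<longleftrightarrow> integrable lborel (\<lambda>u. k (s * u) * g u)"
  using assms lborel_integrable_real_affine_iff[of s "\<lambda>t. k t * g (t / s)" 0]
  by simp

text \<open>With the factor \<open>1 / s\<close> the dilates keep their integral, and their
  derivative in \<open>s\<close> is again a dilate, namely of \<open>g + u g'\<close>. The form
  \<open>within S\<close> serves the fundamental theorem on a closed interval.\<close>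

lemma has_vector_derivative_dilate:
  fixes g :: "real \<Rightarrow> complex"
  assumes g: "(g has_vector_derivative g') (at (t / s))" and s: "s > 0"
  shows "((\<lambda>s. g (t / s) / of_real s) has_vector_derivative
           - (g (t / s) + of_real (t / s) * g') / of_real (s\<^sup>2)) (at s within S)"
proof -
  have 1: "((\<lambda>s. t / s) has_vector_derivative (- t / s\<^sup>2)) (at s)"
    using s by (auto intro!: derivative_eq_intros simp: has_real_derivative_iff_has_vector_derivative[symmetric] power2_eq_square)
  have 2: "((\<lambda>s. of_real (1 / s) :: complex) has_vector_derivative of_real (- 1 / s\<^sup>2)) (at s)"
    using s by (intro has_vector_derivative_of_real)
      (auto intro!: derivative_eq_intros simp: has_real_derivative_iff_has_vector_derivative[symmetric] power2_eq_square)
  have "((\<lambda>s. of_real (1 / s) * (g \<circ> (\<lambda>s. t / s)) s) has_vector_derivative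
      (of_real (1 / s) * ((- t / s\<^sup>2) *\<^sub>R g') + of_real (- 1 / s\<^sup>2) * (g \<circ> (\<lambda>s. t / s)) s)) (at s)"
    by (rule has_vector_derivative_mult[OF 2 vector_diff_chain_at[OF 1 g]])
  moreover have "of_real (1 / s) * ((- t / s\<^sup>2) *\<^sub>R g') + of_real (- 1 / s\<^sup>2) * (g \<circ> (\<lambda>s. t / s)) s
      = - (g (t / s) + of_real (t / s) * g') / of_real (s\<^sup>2)"
    using s by (simp add: scaleR_conv_of_real field_simps power2_eq_square)
  ultimately show ?thesis
    by (simp add: comp_def has_vector_derivative_at_within)
qed

text \<open>
  Dominating \<open>k (s u)\<close> only costs the decay of \<open>g\<close> and \<open>u g'\<close>, whereas differentiating \<open>k (s u)\<close>
  under the integral would in general require decay of \<open>u\<^sup>2 g\<close>. The substitution \<open>t = s u\<close> moves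
  the derivative onto \<open>g\<close>; as \<open>g'\<close> need not be continuous, the difference quotient is written as an
  integral over \<open>s\<close> and treated by Fubini.
\<close>
lemma has_vector_derivative_integral_dilate:
  fixes k g g' :: "real \<Rightarrow> complex" and D :: "real \<Rightarrow> real"
  defines "h \<equiv> \<lambda>u. g u + of_real u * g' u"
  assumes k: "continuous_on UNIV k"
    and g: "\<And>u. (g has_vector_derivative g' u) (at u)"
    and h [measurable]: "h \<in> borel_measurable borel"
    and s0: "s0 > 0"
    and bound: "\<forall>\<^sub>F s in nhds s0. \<forall>u. norm (k (s * u)) \<le> D u"
    and Dg: "integrable lborel (\<lambda>u. D u * norm (g u))"
    and Dh: "integrable lborel (\<lambda>u. D u * norm (h u))"
  shows "((\<lambda>s. \<integral>u. k (s * u) * g u \<partial>lborel) has_vector_derivative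
           - (\<integral>u. k (s0 * u) * h u \<partial>lborel) / of_real s0) (at s0)"
proof -
  have [measurable]: "k \<in> borel_measurable borel"
    using k by (rule borel_measurable_continuous_onI)
  have "continuous_on UNIV g"
    using g has_vector_derivative_continuous continuous_at_imp_continuous_on by blast
  then have [measurable]: "g \<in> borel_measurable borel"
    by (rule borel_measurable_continuous_onI)
  obtain e where e: "e > 0" "\<And>s u. \<bar>s - s0\<bar> < e \<Longrightarrow> norm (k (s * u)) \<le> D u"
    using bound by (auto simp: eventually_nhds_metric dist_real_def)
  \<comment> \<open>Half of each radius keeps the closed interval \<open>{s1..s2}\<close> inside
    both the region of the bound and the positive reals.\<close>
  define d where "d = min (e / 2) (s0 / 2)"
  define s1 where "s1 = s0 - d"
  define s2 where "s2 = s0 + d"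
  have d: "d > 0" "d < e" "d < s0"
    using e s0 by (auto simp: d_def)
  have s1: "s1 > 0" "s1 < s0" "s0 < s2"
    using d by (auto simp: s1_def s2_def)
  have D: "norm (k (s * u)) \<le> D u" if "s \<in> {s1..s2}" for s u
    using that e(2)[of s u] d by (auto simp: s1_def s2_def)
  have int_g: "integrable lborel (\<lambda>u. k (s * u) * g u)" if "s \<in> {s1..s2}" for s
    by (rule Bochner_Integration.integrable_bound[OF Dg])
      (use D[OF that] in \<open>auto simp: norm_mult intro!: mult_right_mono order_trans[OF _ abs_ge_self]\<close>)
  have int_h: "integrable lborel (\<lambda>u. k (s * u) * h u)" if "s \<in> {s1..s2}" for s
    by (rule Bochner_Integration.integrable_bound[OF Dh])
      (use D[OF that] in \<open>auto simp: norm_mult intro!: mult_right_mono order_trans[OF _ abs_ge_self]\<close>)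
  define f where "f s = (\<integral>u. k (s * u) * g u \<partial>lborel)" for s
  \<comment> \<open>The expected derivative at every \<open>s\<close>, not only at
    \<open>s0\<close>: it is continuous, so it suffices to show that \<open>f\<close> is an
    indefinite integral of it.\<close>
  define \<Psi> where "\<Psi> s = - (\<integral>u. k (s * u) * h u \<partial>lborel) / of_real s" for s
  have cont: "continuous_on {s1..s2} \<Psi>"
  proof (rule continuous_at_imp_continuous_on, rule ballI)
    fix s assume s: "s \<in> {s1..s2}"
    have "((\<lambda>s. \<integral>u. k (s * u) * h u \<partial>lborel) \<longlongrightarrow> (\<integral>u. k (s * u) * h u \<partial>lborel)) (at s)"
    proof (rule tendsto_integral_at[OF _ _ Dh])
      have "\<forall>\<^sub>F s' in nhds s. s' \<in> {s0 - e <..< s0 + e}"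
        by (rule eventually_nhds_in_open) (use s d in \<open>auto simp: s1_def s2_def\<close>)
      then have "\<forall>\<^sub>F s' in nhds s. \<forall>u. norm (k (s' * u) * h u) \<le> D u * norm (h u)"
        by eventually_elim (auto simp: norm_mult intro!: mult_right_mono e(2))
      then show "\<forall>\<^sub>F s' in at s. \<forall>u. norm (k (s' * u) * h u) \<le> D u * norm (h u)"
        by (simp add: eventually_at_filter eventually_mono)
      have "isCont k x" for x
        using k by (simp add: continuous_on_eq_continuous_at)
      then show "((\<lambda>s'. k (s' * u) * h u) \<longlongrightarrow> k (s * u) * h u) (at s)" for u
        by (intro tendsto_intros isCont_tendsto_compose[of _ k])
    qed auto
    then show "isCont \<Psi> s"
      using s s1 unfolding isCont_def \<Psi>_def by (intro tendsto_intros) auto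
  qed
  have f_eq: "f s = f s1 + integral {s1..s} \<Psi>" if s: "s \<in> {s1..s2}" for s
  proof -
    \<comment> \<open>This is \<open>k t\<close> times the derivative in \<tau> of
      \<open>g (t / \<tau>) / \<tau>\<close>, cut off to \<open>{s1..s}\<close>. Integrating over
      \<tau> first gives the increment of \<open>f\<close> by the fundamental theorem; integrating
      over \<open>t\<close> first gives \<Psi>.\<close>
    define \<phi> where "\<phi> \<tau> t = indicator {s1..s} \<tau> *\<^sub>R (k t * (- h (t / \<tau>) / of_real (\<tau>\<^sup>2)))" for \<tau> t
    have pos: "\<tau> > 0" "\<tau> \<in> {s1..s2}" if "\<tau> \<in> {s1..s}" for \<tau>
      using that s s1 by auto
    have sect: "integrable lborel (\<phi> \<tau>)" for \<tau>
    proof (cases "\<tau> \<in> {s1..s}")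
      case True
      with int_h[of \<tau>] pos[of \<tau>] have "integrable lborel (\<lambda>t. k t * h (t / \<tau>))"
        by (subst integrable_dilate_iff) auto
      from integrable_mult_left[OF this, of "- 1 / of_real (\<tau>\<^sup>2)"] show ?thesis
        using True by (simp add: \<phi>_def[abs_def] field_simps)
    qed (simp add: \<phi>_def[abs_def])
    \<comment> \<open>The substitution \<open>t = \<tau> u\<close> contributes \<tau> against the
      \<tau> squared in the denominator, and \<open>1 / \<tau>\<close> is at most
      \<open>1 / s1\<close>.\<close>
    have norm_le: "(\<integral>t. norm (\<phi> \<tau> t) \<partial>lborel) \<le> (\<integral>u. D u * norm (h u) \<partial>lborel) / s1 * indicator {s1..s} \<tau>" for \<tau>
    proof (cases "\<tau> \<in> {s1..s}")
      case True
      have "(\<integral>t. norm (\<phi> \<tau> t) \<partial>lborel) = \<tau> * (\<integral>u. norm (\<phi> \<tau> (\<tau> * u)) \<partial>lborel)"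
        using lborel_integral_real_affine[of \<tau> "\<lambda>t. norm (\<phi> \<tau> t)" 0] pos[OF True] by simp
      also have "(\<lambda>u. norm (\<phi> \<tau> (\<tau> * u))) = (\<lambda>u. norm (k (\<tau> * u) * h u) / \<tau>\<^sup>2)"
        using True pos[OF True] by (auto simp: \<phi>_def norm_mult norm_divide norm_power)
      also have "\<tau> * (\<integral>u. norm (k (\<tau> * u) * h u) / \<tau>\<^sup>2 \<partial>lborel) = (\<integral>u. norm (k (\<tau> * u) * h u) \<partial>lborel) / \<tau>"
        using pos[OF True] by (simp add: power2_eq_square)
      also have "\<dots> \<le> (\<integral>u. D u * norm (h u) \<partial>lborel) / \<tau>"
      proof (rule divide_right_mono)
        show "(\<integral>u. norm (k (\<tau> * u) * h u) \<partial>lborel) \<le> (\<integral>u. D u * norm (h u) \<partial>lborel)"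
          by (rule integral_mono[OF integrable_norm[OF int_h[OF pos(2)[OF True]]] Dh])
            (use D[OF pos(2)[OF True]] in \<open>auto simp: norm_mult intro!: mult_right_mono\<close>)
      qed (use pos[OF True] in simp)
      also have "\<dots> \<le> (\<integral>u. D u * norm (h u) \<partial>lborel) / s1"
      proof (rule divide_left_mono)
        have "0 \<le> D u * norm (h u)" for u
          using order_trans[OF norm_ge_zero D[of s0 u]] s1 by simp
        then show "0 \<le> (\<integral>u. D u * norm (h u) \<partial>lborel)"
          by simp
      qed (use True pos[OF True] s1 in auto)
      finally show ?thesis
        using True by simp
    qed (simp add: \<phi>_def)
    have \<phi>_meas [measurable]: "case_prod \<phi> \<in> borel_measurable (lborel \<Otimes>\<^sub>M lborel)"
      unfolding \<phi>_def by measurable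
    have \<phi>_int: "integrable (lborel \<Otimes>\<^sub>M lborel) (case_prod \<phi>)"
    proof (rule lborel_pair.Fubini_integrable)
      show "integrable lborel (\<lambda>\<tau>. \<integral>t. norm (case (\<tau>, t) of (\<tau>, t) \<Rightarrow> \<phi> \<tau> t) \<partial>lborel)"
      proof (rule Bochner_Integration.integrable_bound)
        show "integrable lborel (\<lambda>\<tau>. (\<integral>u. D u * norm (h u) \<partial>lborel) / s1 * indicator {s1..s} \<tau>)"
          by (intro integrable_mult_right integrable_real_indicator) (simp_all add: emeasure_lborel_Icc_eq)
        show "AE \<tau> in lborel. norm (\<integral>t. norm (case (\<tau>, t) of (\<tau>, t) \<Rightarrow> \<phi> \<tau> t) \<partial>lborel)
          \<le> norm ((\<integral>u. D u * norm (h u) \<partial>lborel) / s1 * indicator {s1..s} \<tau>)"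
          using order_trans[OF norm_le abs_ge_self] by (intro AE_I2) simp
      qed measurable
    qed (use sect in auto)
    have "(\<integral>t. (\<integral>\<tau>. \<phi> \<tau> t \<partial>lborel) \<partial>lborel) = (\<integral>t. k t * (g (t / s) / of_real s) - k t * (g (t / s1) / of_real s1) \<partial>lborel)"
    proof (rule integral_cong_AE)
      \<comment> \<open>The fundamental theorem yields a gauge integral, as \<open>g'\<close> may be
        discontinuous. Fubini supplies Lebesgue integrability for almost every \<open>t\<close>, and
        there the two integrals agree.\<close>
      have "AE t in lborel. integrable lborel (\<lambda>\<tau>. \<phi> \<tau> t)"
        using lborel_pair.AE_integrable_snd[OF \<phi>_int] .
      then show "AE t in lborel. (\<integral>\<tau>. \<phi> \<tau> t \<partial>lborel) = k t * (g (t / s) / of_real s) - k t * (g (t / s1) / of_real s1)"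
      proof eventually_elim
        case (elim t)
        have int_eq: "((\<lambda>\<tau>. k t * (- h (t / \<tau>) / of_real (\<tau>\<^sup>2))) has_integral
            k t * (g (t / s) / of_real s) - k t * (g (t / s1) / of_real s1)) {s1..s}"
        proof (rule fundamental_theorem_of_calculus)
          show "s1 \<le> s"
            using s by simp
          show "((\<lambda>\<tau>. k t * (g (t / \<tau>) / of_real \<tau>)) has_vector_derivative k t * (- h (t / \<tau>) / of_real (\<tau>\<^sup>2)))
              (at \<tau> within {s1..s})" if "\<tau> \<in> {s1..s}" for \<tau>
            using has_vector_derivative_dilate[OF g pos(1)[OF that]]
            unfolding h_def by (intro has_vector_derivative_mult_right)
        qed
        have "(\<integral>\<tau>. \<phi> \<tau> t \<partial>lborel) = integral {s1..s} (\<lambda>\<tau>. k t * (- h (t / \<tau>) / of_real (\<tau>\<^sup>2)))"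
          using set_borel_integral_eq_integral(2)[of "{s1..s}" "\<lambda>\<tau>. k t * (- h (t / \<tau>) / of_real (\<tau>\<^sup>2))"] elim
          by (simp add: set_integrable_def set_lebesgue_integral_def \<phi>_def)
        then show ?case
          unfolding integral_unique[OF int_eq] .
      qed
    qed measurable
    also have "\<dots> = (\<integral>t. k t * g (t / s) \<partial>lborel) / of_real s - (\<integral>t. k t * g (t / s1) \<partial>lborel) / of_real s1"
    proof -
      have "integrable lborel (\<lambda>t. k t * g (t / \<tau>))" if "\<tau> \<in> {s1..s}" for \<tau>
        using int_g[of \<tau>] pos[OF that] by (subst integrable_dilate_iff) auto
      from this[of s] this[of s1] s show ?thesis
        by simp
    qed
    also have "\<dots> = f s - f s1"
      using s s1 by (simp add: integral_dilate f_def)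
    finally have "f s - f s1 = (\<integral>\<tau>. (\<integral>t. \<phi> \<tau> t \<partial>lborel) \<partial>lborel)"
      using lborel_pair.Fubini_integral[OF \<phi>_int] by simp
    also have "(\<lambda>\<tau>. \<integral>t. \<phi> \<tau> t \<partial>lborel) = (\<lambda>\<tau>. indicator {s1..s} \<tau> *\<^sub>R \<Psi> \<tau>)"
    proof
      fix \<tau>
      show "(\<integral>t. \<phi> \<tau> t \<partial>lborel) = indicator {s1..s} \<tau> *\<^sub>R \<Psi> \<tau>"
      proof (cases "\<tau> \<in> {s1..s}")
        case True
        have "(\<integral>t. \<phi> \<tau> t \<partial>lborel) = (\<integral>t. k t * h (t / \<tau>) * (- 1 / of_real (\<tau>\<^sup>2)) \<partial>lborel)"
          using True by (simp add: \<phi>_def)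
        also have "\<dots> = \<Psi> \<tau>"
          using pos[OF True] by (simp only: integral_mult_left_zero integral_dilate \<Psi>_def) (simp add: power2_eq_square)
        finally show ?thesis
          using True by simp
      qed (simp add: \<phi>_def)
    qed
    also have "(\<integral>\<tau>. indicator {s1..s} \<tau> *\<^sub>R \<Psi> \<tau> \<partial>lborel) = integral {s1..s} \<Psi>"
      using set_borel_integral_eq_integral(2)[of "{s1..s}" \<Psi>]
        borel_integrable_atLeastAtMost'[OF continuous_on_subset[OF cont, of "{s1..s}"]] s
      by (simp add: set_lebesgue_integral_def)
    finally show ?thesis
      by (simp add: algebra_simps)
  qed
  have "((\<lambda>s. f s1 + integral {s1..s} \<Psi>) has_vector_derivative \<Psi> s0) (at s0 within {s1..s2})"
    using integral_has_vector_derivative[OF cont, of s0] s1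
    by (auto intro!: derivative_eq_intros)
  then have "((\<lambda>s. f s1 + integral {s1..s} \<Psi>) has_vector_derivative \<Psi> s0) (at s0)"
    using s1 by (simp add: at_within_Icc_at)
  then have "(f has_vector_derivative \<Psi> s0) (at s0)"
    by (rule has_vector_derivative_transform_within_open[of _ _ _ "{s1<..<s2}"])
      (use s1 in \<open>auto intro!: f_eq[symmetric]\<close>)
  then show ?thesis
    by (simp add: f_def[abs_def] \<Psi>_def)
qed

section \<open>Local domination by Gaussians\<close>

lemma eventually_nhds_real_pairD:
  fixes x0 y0 :: real
  assumes "\<forall>\<^sub>F (x, y) in nhds (x0, y0). P x y"
  obtains e where "e > 0" "\<And>x y. \<bar>x - x0\<bar> < e \<Longrightarrow> \<bar>y - y0\<bar> < e \<Longrightarrow> P x y"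
proof -
  obtain Pf Pg where Pf: "eventually Pf (nhds x0)" and Pg: "eventually Pg (nhds y0)"
    and P: "\<And>x y. Pf x \<Longrightarrow> Pg y \<Longrightarrow> P x y"
    using assms unfolding nhds_prod eventually_prod_filter by auto
  obtain e1 where e1: "e1 > 0" "\<And>x. \<bar>x - x0\<bar> < e1 \<Longrightarrow> Pf x"
    using Pf by (auto simp: eventually_nhds_metric dist_real_def)
  obtain e2 where e2: "e2 > 0" "\<And>y. \<bar>y - y0\<bar> < e2 \<Longrightarrow> Pg y"
    using Pg by (auto simp: eventually_nhds_metric dist_real_def)
  show ?thesis
    by (rule that[of "min e1 e2"]) (use e1 e2 P in auto)
qed

lemma integrable_exp_sum_mult:
  fixes H f1 f2 :: "real \<Rightarrow> real"
  assumes "integrable M (\<lambda>u. exp (f1 u) * H u)" "integrable M (\<lambda>u. exp (f2 u) * H u)"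
  shows "integrable M (\<lambda>u. (exp (f1 u) + exp (f2 u)) * H u)"
  using Bochner_Integration.integrable_add[OF assms] by (simp add: distrib_right)

text \<open>
  The exponent is affine in \<open>\<zeta> = q \<alpha>\<^sup>2 / 2\<close> and \<open>\<eta> = \<alpha> (p + q \<beta>)\<close>. For \<open>q \<noteq> 0\<close> these are local
  coordinates, so finitely many nearby points dominate a whole neighbourhood; for \<open>q = 0\<close> the
  exponent is already affine in \<open>\<alpha>\<close>.
\<close>
lemma gaussian_local_dominator:
  fixes H :: "real \<Rightarrow> real" and p q \<alpha>0 \<beta>0 :: real
  assumes \<alpha>0: "\<alpha>0 > 0"
    and ev: "\<forall>\<^sub>F (\<alpha>, \<beta>) in nhds (\<alpha>0, \<beta>0).
      integrable lborel (\<lambda>u. exp (q * \<alpha>\<^sup>2 / 2 * u\<^sup>2 + \<alpha> * (p + q * \<beta>) * u) * H u)"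
  obtains D :: "real \<Rightarrow> real" where "integrable lborel (\<lambda>u. D u * H u)" "D \<in> borel_measurable borel"
    "\<forall>\<^sub>F (\<alpha>, \<beta>) in nhds (\<alpha>0, \<beta>0). \<forall>u. exp (q * \<alpha>\<^sup>2 / 2 * u\<^sup>2 + \<alpha> * (p + q * \<beta>) * u) \<le> D u"
proof (cases "q = 0")
  case True
  obtain e where e: "e > 0" "\<And>\<alpha>. \<bar>\<alpha> - \<alpha>0\<bar> < e \<Longrightarrow> integrable lborel (\<lambda>u. exp (\<alpha> * p * u) * H u)"
    using eventually_nhds_real_pairD[OF ev] True by (simp, metis abs_zero diff_self)
  \<comment> \<open>A linear function of \<alpha> on an interval is largest at an endpoint; which
    one depends on the sign of \<open>p * u\<close>, so both are summed. The radius
    \<open>e / 2\<close> keeps the endpoints where integrability is known.\<close>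
  define D where "D u = exp ((\<alpha>0 - e / 2) * p * u) + exp ((\<alpha>0 + e / 2) * p * u)" for u
  show ?thesis
  proof
    show "integrable lborel (\<lambda>u. D u * H u)"
      unfolding D_def by (intro integrable_exp_sum_mult e(2)) (use e(1) in auto)
    show "D \<in> borel_measurable borel"
      unfolding D_def by measurable
    have "\<forall>\<^sub>F z in nhds (\<alpha>0, \<beta>0). fst z \<in> {\<alpha>0 - e / 2 <..< \<alpha>0 + e / 2}"
      by (rule eventually_compose_filterlim[OF eventually_nhds_in_open, of _ "fst (\<alpha>0, \<beta>0)"])
        (use e(1) tendsto_fst[OF filterlim_ident, of "(\<alpha>0, \<beta>0)"] in auto)
    then show "\<forall>\<^sub>F (\<alpha>, \<beta>) in nhds (\<alpha>0, \<beta>0). \<forall>u. exp (q * \<alpha>\<^sup>2 / 2 * u\<^sup>2 + \<alpha> * (p + q * \<beta>) * u) \<le> D u"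
    proof (eventually_elim, clarsimp simp: True)
      fix \<alpha> u :: real
      assume \<alpha>: "\<alpha>0 - e / 2 < \<alpha>" "\<alpha> < \<alpha>0 + e / 2"
      have "\<alpha> * p * u \<le> max ((\<alpha>0 - e / 2) * p * u) ((\<alpha>0 + e / 2) * p * u)"
      proof (cases "p * u \<ge> 0")
        case True
        then show ?thesis
          using mult_right_mono[of \<alpha> "\<alpha>0 + e / 2" "p * u"] \<alpha> by (simp add: mult.assoc)
      next
        case False
        then show ?thesis
          using mult_right_mono_neg[of "\<alpha>0 - e / 2" \<alpha> "p * u"] \<alpha> by (simp add: mult.assoc)
      qed
      then have "exp (\<alpha> * p * u) \<le> exp (max ((\<alpha>0 - e / 2) * p * u) ((\<alpha>0 + e / 2) * p * u))"
        by simp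
      also have "\<dots> \<le> D u"
        by (simp add: D_def max_def)
      finally show "exp (\<alpha> * p * u) \<le> D u" .
    qed
  qed
next
  case q: False
  define \<zeta>0 where "\<zeta>0 = q * \<alpha>0\<^sup>2 / 2"
  define \<eta>0 where "\<eta>0 = \<alpha>0 * (p + q * \<beta>0)"
  define c where "c = (\<zeta>0, \<eta>0)"
  have \<zeta>0: "2 * \<zeta>0 / q = \<alpha>0\<^sup>2"
    using q by (simp add: \<zeta>0_def)
  \<comment> \<open>The explicit inverse of (\<alpha>, \<beta>) to (\<zeta>, \<eta>), on the branch
    of positive \<alpha>. Its continuity at \<open>c\<close> carries the integrability hypothesis
    over to the new coordinates.\<close>
  have "((\<lambda>z. (sqrt (2 * fst z / q), (snd z / sqrt (2 * fst z / q) - p) / q)) \<longlongrightarrow>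
      (sqrt (2 * fst c / q), (snd c / sqrt (2 * fst c / q) - p) / q)) (nhds c)"
    using q \<alpha>0 \<zeta>0 by (intro tendsto_intros filterlim_ident) (auto simp: c_def)
  also have "(sqrt (2 * fst c / q), (snd c / sqrt (2 * fst c / q) - p) / q) = (\<alpha>0, \<beta>0)"
    using q \<alpha>0 \<zeta>0 by (simp add: c_def \<eta>0_def)
  finally have "\<forall>\<^sub>F z in nhds c. case (sqrt (2 * fst z / q), (snd z / sqrt (2 * fst z / q) - p) / q) of (\<alpha>, \<beta>) \<Rightarrow>
      integrable lborel (\<lambda>u. exp (q * \<alpha>\<^sup>2 / 2 * u\<^sup>2 + \<alpha> * (p + q * \<beta>) * u) * H u)"
    by (rule eventually_compose_filterlim[OF ev])
  \<comment> \<open>Only where the radicand is positive does the formula with the square root really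
    invert the change of coordinates.\<close>
  moreover have "\<forall>\<^sub>F z in nhds c. 2 * fst z / q > 0"
  proof (rule order_tendstoD)
    show "((\<lambda>z. 2 * fst z / q) \<longlongrightarrow> 2 * fst c / q) (nhds c)"
      using q by (intro tendsto_intros filterlim_ident) auto
  qed (use \<zeta>0 \<alpha>0 in \<open>simp add: c_def\<close>)
  ultimately have "\<forall>\<^sub>F z in nhds c. integrable lborel (\<lambda>u. exp (fst z * u\<^sup>2 + snd z * u) * H u)"
  proof eventually_elim
    case (elim z)
    have "q * (sqrt (2 * fst z / q))\<^sup>2 / 2 = fst z"
      using elim(2) q by simp
    moreover have "sqrt (2 * fst z / q) * (p + q * ((snd z / sqrt (2 * fst z / q) - p) / q)) = snd z"
      using elim(2) q by (metis add_diff_cancel_left' add_diff_eq eq_divide_eq less_numeral_extra(3) mult.commute real_sqrt_gt_zero)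
    ultimately show ?case
      using elim(1) by simp
  qed
  then have "\<forall>\<^sub>F (\<zeta>, \<eta>) in nhds (\<zeta>0, \<eta>0). integrable lborel (\<lambda>u. exp (\<zeta> * u\<^sup>2 + \<eta> * u) * H u)"
    by (simp add: c_def case_prod_unfold)
  then obtain e where e: "e > 0"
    "\<And>\<zeta> \<eta>. \<bar>\<zeta> - \<zeta>0\<bar> < e \<Longrightarrow> \<bar>\<eta> - \<eta>0\<bar> < e \<Longrightarrow> integrable lborel (\<lambda>u. exp (\<zeta> * u\<^sup>2 + \<eta> * u) * H u)"
    using eventually_nhds_real_pairD by (smt (verit))
  \<comment> \<open>Two corners of the box suffice: \<open>u\<^sup>2\<close> is nonnegative, so only
    the upper end for \<zeta> matters, while the sign of \<open>u\<close> selects the end for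
    \<eta>.\<close>
  define D where "D u = exp ((\<zeta>0 + e / 2) * u\<^sup>2 + (\<eta>0 - e / 2) * u) + exp ((\<zeta>0 + e / 2) * u\<^sup>2 + (\<eta>0 + e / 2) * u)" for u
  show ?thesis
  proof
    show "integrable lborel (\<lambda>u. D u * H u)"
      unfolding D_def by (intro integrable_exp_sum_mult e(2)) (use e(1) in auto)
    show "D \<in> borel_measurable borel"
      unfolding D_def by measurable
    \<comment> \<open>Continuity of the forward map brings the domination from the box back to a
      neighbourhood of (\<alpha>0, \<beta>0).\<close>
    have lim: "((\<lambda>z. (q * (fst z)\<^sup>2 / 2, fst z * (p + q * snd z))) \<longlongrightarrow>
        (q * (fst (\<alpha>0, \<beta>0))\<^sup>2 / 2, fst (\<alpha>0, \<beta>0) * (p + q * snd (\<alpha>0, \<beta>0)))) (nhds (\<alpha>0, \<beta>0))"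
      by (intro tendsto_intros filterlim_ident) auto
    have "open ({\<zeta>0 - e / 2 <..< \<zeta>0 + e / 2} \<times> {\<eta>0 - e / 2 <..< \<eta>0 + e / 2})"
      by (intro open_Times open_greaterThanLessThan)
    then have "\<forall>\<^sub>F z in nhds (\<alpha>0, \<beta>0). (q * (fst z)\<^sup>2 / 2, fst z * (p + q * snd z)) \<in>
        {\<zeta>0 - e / 2 <..< \<zeta>0 + e / 2} \<times> {\<eta>0 - e / 2 <..< \<eta>0 + e / 2}"
      by (rule eventually_compose_filterlim[OF eventually_nhds_in_open lim])
        (use e(1) in \<open>auto simp: \<zeta>0_def \<eta>0_def\<close>)
    then show "\<forall>\<^sub>F (\<alpha>, \<beta>) in nhds (\<alpha>0, \<beta>0). \<forall>u. exp (q * \<alpha>\<^sup>2 / 2 * u\<^sup>2 + \<alpha> * (p + q * \<beta>) * u) \<le> D u"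
    proof eventually_elim
      case (elim z)
      obtain \<alpha> \<beta> where z: "z = (\<alpha>, \<beta>)"
        by (cases z)
      define \<zeta> where "\<zeta> = q * \<alpha>\<^sup>2 / 2"
      define \<eta> where "\<eta> = \<alpha> * (p + q * \<beta>)"
      have in_box: "\<zeta> \<le> \<zeta>0 + e / 2" "\<eta>0 - e / 2 \<le> \<eta>" "\<eta> \<le> \<eta>0 + e / 2"
        using elim by (auto simp: z \<zeta>_def \<eta>_def)
      have "exp (\<zeta> * u\<^sup>2 + \<eta> * u) \<le> D u" for u
      proof -
        have "\<zeta> * u\<^sup>2 \<le> (\<zeta>0 + e / 2) * u\<^sup>2"
          using in_box by (intro mult_right_mono) auto
        moreover have "\<eta> * u \<le> max ((\<eta>0 - e / 2) * u) ((\<eta>0 + e / 2) * u)"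
          using in_box mult_right_mono[of \<eta> "\<eta>0 + e / 2" u] mult_right_mono_neg[of "\<eta>0 - e / 2" \<eta> u]
          by (cases "u \<ge> 0") auto
        ultimately have "exp (\<zeta> * u\<^sup>2 + \<eta> * u) \<le>
            exp ((\<zeta>0 + e / 2) * u\<^sup>2 + max ((\<eta>0 - e / 2) * u) ((\<eta>0 + e / 2) * u))"
          by simp
        also have "\<dots> \<le> D u"
          by (simp add: D_def max_def)
        finally show ?thesis .
      qed
      then show ?case
        by (simp add: z \<zeta>_def \<eta>_def)
    qed
  qed
qed

section \<open>Difference quotients of complex-valued functions\<close>

text \<open>Mean value estimate on the segment from 0 to \<open>y\<close>, where the real part stays
  between 0 and \<open>Re y\<close>. The maximum is kept because, multiplied by a kernel, it turns
  into the larger of two kernel moduli.\<close>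

lemma norm_exp_minus_one_le:
  fixes y :: complex
  shows "norm (exp y - 1) \<le> norm y * max 1 (exp (Re y))"
proof -
  have "norm (exp y - exp 0) \<le> max 1 (exp (Re y)) * norm (y - 0)"
  proof (rule field_differentiable_bound[where S = "closed_segment 0 y" and f' = exp])
    show "norm (exp z) \<le> max 1 (exp (Re y))" if z: "z \<in> closed_segment 0 y" for z
    proof -
      obtain t where t: "0 \<le> t" "t \<le> 1" "z = t *\<^sub>R y"
        using z by (auto simp: in_segment)
      have "t * Re y \<le> max 0 (Re y)"
        using t mult_left_le_one_le[of "Re y" t] by (cases "Re y \<ge> 0") (auto simp: mult_nonneg_nonpos)
      then have "exp (t * Re y) \<le> exp (max 0 (Re y))"
        by simp
      also have "\<dots> = max 1 (exp (Re y))"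
        by (simp add: max_def)
      finally show ?thesis
        using t by simp
    qed
  qed (auto intro!: derivative_eq_intros)
  then show ?thesis
    by (simp add: mult.commute)
qed

text \<open>Puts derivatives into the form of a plain limit, to which dominated convergence
  applies.\<close>

lemma has_vector_derivative_iff_quotient:
  fixes f :: "real \<Rightarrow> complex"
  shows "(f has_vector_derivative D) (at x) \<longleftrightarrow> ((\<lambda>y. (f y - f x) / of_real (y - x)) \<longlongrightarrow> D) (at x)"
proof -
  have "(f has_vector_derivative D) (at x) \<longleftrightarrow>
      ((\<lambda>y. norm (f y - f x - (y - x) *\<^sub>R D) / norm (y - x)) \<longlongrightarrow> 0) (at x)"
    by (simp add: has_vector_derivative_def has_derivative_iff_norm bounded_linear_scaleR_left)
  also have "\<dots> \<longleftrightarrow> ((\<lambda>y. norm ((f y - f x) / of_real (y - x) - D)) \<longlongrightarrow> 0) (at x)"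
  proof (rule filterlim_cong)
    show "\<forall>\<^sub>F y in at x. norm (f y - f x - (y - x) *\<^sub>R D) / norm (y - x) = norm ((f y - f x) / of_real (y - x) - D)"
      unfolding eventually_at_filter
    proof (rule always_eventually, intro allI impI)
      fix y assume "y \<noteq> x"
      then have "(f y - f x) / of_real (y - x) - D = (f y - f x - (y - x) *\<^sub>R D) / of_real (y - x)"
        by (simp add: scaleR_conv_of_real diff_divide_distrib)
      then show "norm (f y - f x - (y - x) *\<^sub>R D) / norm (y - x) = norm ((f y - f x) / of_real (y - x) - D)"
        by (simp only: norm_divide norm_of_real real_norm_def)
    qed
  qed auto
  finally show ?thesis
    by (simp add: tendsto_norm_zero_iff Lim_null[of _ D])
qed

section \<open>The transform of an LFM signal\<close>

text \<open>
  Expanding the exponent around \<open>b\<close>, the LFM signal factors as \<open>x (b + a t) = x b \<cdot> K t\<close> with a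
  Gaussian kernel; the modulation \<open>exp (- 2 \<pi> \<i> \<mu> t)\<close> is absorbed into it. Here \<open>P = p + 2 \<pi> \<i> c\<close>
  and \<open>Q = q + 2 \<pi> \<i> r\<close>.
\<close>
definition lfm_kernel :: "real \<Rightarrow> complex \<Rightarrow> complex \<Rightarrow> real \<Rightarrow> real \<Rightarrow> real \<Rightarrow> complex" where
  "lfm_kernel \<mu> P Q a b v =
     exp (of_real (a\<^sup>2) * Q / 2 * of_real (v\<^sup>2) + (of_real a * (P + Q * of_real b) - \<i> * of_real (2 * pi * \<mu>)) * of_real v)"

text \<open>The modulation and the imaginary parts of \<open>P\<close> and \<open>Q\<close> drop
  out, so scale and dilation enter only through \<alpha> = \<open>a * s\<close>. Hence domination is
  a question about two parameters, \<alpha> and \<beta> = \<open>b\<close>.\<close>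

lemma norm_lfm_kernel:
  "norm (lfm_kernel \<mu> P Q a b (s * u)) =
     exp (Re Q * (a * s)\<^sup>2 / 2 * u\<^sup>2 + a * s * (Re P + Re Q * b) * u)"
  by (simp add: lfm_kernel_def power_mult_distrib algebra_simps)

lemma continuous_on_lfm_kernel: "continuous_on UNIV (lfm_kernel \<mu> P Q a b)"
  unfolding lfm_kernel_def[abs_def] by (intro continuous_intros)

lemma borel_measurable_lfm_kernel [measurable]: "lfm_kernel \<mu> P Q a b \<in> borel_measurable borel"
  using continuous_on_lfm_kernel by (rule borel_measurable_continuous_onI)

lemma lfm_kernel_nonzero: "lfm_kernel \<mu> P Q a b v \<noteq> 0"
  by (simp add: lfm_kernel_def)

text \<open>The exponent is affine in \<open>b\<close>, and \<open>b\<close> occurs only in the term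
  linear in \<open>v\<close>.\<close>

lemma lfm_kernel_shift:
  "lfm_kernel \<mu> P Q a b' v = lfm_kernel \<mu> P Q a b v * exp (of_real (a * (b' - b) * v) * Q)"
  by (simp add: lfm_kernel_def exp_add[symmetric] algebra_simps)

lemma lfm_signal_eq:
  "lfm_signal A p q c r t =
     of_real A * exp (Complex p (2 * pi * c) * of_real t + Complex q (2 * pi * r) * of_real (t\<^sup>2) / 2)"
  unfolding lfm_signal_def lfm_amplitude_def lfm_phase_def
  by (simp add: exp_of_real[symmetric] exp_add[symmetric] complex_eq_iff algebra_simps add_divide_distrib)
    (simp add: Complex_eq complex_eq_iff algebra_simps add_divide_distrib)

lemma lfm_signal_eq_0_iff: "lfm_signal A p q c r t = 0 \<longleftrightarrow> A = 0"
  by (simp add: lfm_signal_eq)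

lemma has_vector_derivative_lfm_signal:
  "(lfm_signal A p q c r has_vector_derivative
     (Complex p (2 * pi * c) + Complex q (2 * pi * r) * of_real t) * lfm_signal A p q c r t) (at t)"
proof -
  have "((\<lambda>z. of_real A * exp (Complex p (2 * pi * c) * z + Complex q (2 * pi * r) * z\<^sup>2 / 2)) has_field_derivative
      (Complex p (2 * pi * c) + Complex q (2 * pi * r) * of_real t) * lfm_signal A p q c r t) (at (of_real t))"
    by (auto intro!: derivative_eq_intros simp: lfm_signal_eq algebra_simps)
  from has_vector_derivative_real_field[OF this] show ?thesis
    by (simp add: lfm_signal_eq[abs_def])
qed

lemma adp_cwt_integrand_lfm:
  "adp_cwt_integrand \<mu> \<sigma> h (lfm_signal A p q c r) a b t =
     lfm_signal A p q c r b / of_real (\<sigma> b) *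
       (lfm_kernel \<mu> (Complex p (2 * pi * c)) (Complex q (2 * pi * r)) a b t * h (t / \<sigma> b))"
proof -
  have "lfm_signal A p q c r (b + a * t) * exp (- (\<i> * complex_of_real (2 * pi * \<mu> * t))) =
      lfm_signal A p q c r b * lfm_kernel \<mu> (Complex p (2 * pi * c)) (Complex q (2 * pi * r)) a b t"
    unfolding lfm_signal_eq lfm_kernel_def
    by (simp add: exp_add[symmetric] power2_eq_square algebra_simps add_divide_distrib)
  then show ?thesis
    unfolding adp_cwt_integrand_def by (simp add: field_simps)
qed

text \<open>After \<open>t = \<sigma> b * u\<close> the Jacobian cancels the factor
  \<open>1 / \<sigma> b\<close>, and \<sigma> acts on the smooth kernel instead of the
  window.\<close>

lemma adp_cwt_lfm:
  assumes "\<sigma> b > 0"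
  shows "adp_cwt \<mu> \<sigma> h (lfm_signal A p q c r) a b = lfm_signal A p q c r b *
     (\<integral>u. lfm_kernel \<mu> (Complex p (2 * pi * c)) (Complex q (2 * pi * r)) a b (\<sigma> b * u) * h u \<partial>lborel)"
  using assms by (simp add: adp_cwt_def adp_cwt_integrand_lfm[abs_def] integral_dilate)

lemma adp_cwt_exists_lfm_iff:
  assumes "\<sigma> b > 0" "A \<noteq> 0"
  shows "adp_cwt_exists \<mu> \<sigma> h (lfm_signal A p q c r) a b \<longleftrightarrow> integrable lborel
     (\<lambda>u. lfm_kernel \<mu> (Complex p (2 * pi * c)) (Complex q (2 * pi * r)) a b (\<sigma> b * u) * h u)"
proof -
  have "lfm_signal A p q c r b / of_real (\<sigma> b) \<noteq> 0"
    using assms by (simp add: lfm_signal_eq_0_iff)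
  then have mult: "integrable lborel (\<lambda>t. lfm_signal A p q c r b / of_real (\<sigma> b) * f t) \<longleftrightarrow> integrable lborel f" for f
    using set_integrable_mult_right_iff[of "lfm_signal A p q c r b / of_real (\<sigma> b)" lborel UNIV f]
    by (simp only: set_integrable_def indicator_UNIV scaleR_one simp_thms)
  show ?thesis
    unfolding adp_cwt_exists_def adp_cwt_integrand_lfm[abs_def]
    by (rule trans[OF mult integrable_dilate_iff[OF assms(1)]])
qed

section \<open>Differentiation of the transform in the time variable\<close>

text \<open>The variable \<open>b'\<close> enters through the kernel and through \<sigma>. The
  integral is split as \<open>F b' (\<sigma> b') - F b (\<sigma> b')\<close> plus
  \<open>F b (\<sigma> b')\<close>: the latter is a dilation composed with \<sigma>, the former has
  a difference quotient to which dominated convergence applies with \<open>\<sigma> b'\<close> still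
  moving. No joint differentiability of \<open>F\<close> has to be shown.\<close>

lemma has_vector_derivative_lfm_integral:
  fixes g g' :: "real \<Rightarrow> complex" and D \<sigma> :: "real \<Rightarrow> real" and P Q :: complex and \<mu> a b \<sigma>' :: real
  defines "h \<equiv> \<lambda>u. g u + of_real u * g' u"
    and "K \<equiv> lfm_kernel \<mu> P Q a"
  assumes g: "\<And>u. (g has_vector_derivative g' u) (at u)"
    and h: "h \<in> borel_measurable borel"
    and \<sigma>: "(\<sigma> has_real_derivative \<sigma>') (at b)" "\<sigma> b > 0"
    and bound: "\<forall>\<^sub>F (\<alpha>, \<beta>) in nhds (a * \<sigma> b, b).
      \<forall>u. exp (Re Q * \<alpha>\<^sup>2 / 2 * u\<^sup>2 + \<alpha> * (Re P + Re Q * \<beta>) * u) \<le> D u"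
    and Dg: "integrable lborel (\<lambda>u. D u * norm (g u))"
    and Dg1: "integrable lborel (\<lambda>u. D u * norm (of_real u * g u))"
    and Dh: "integrable lborel (\<lambda>u. D u * norm (h u))"
  shows "((\<lambda>b'. \<integral>u. K b' (\<sigma> b' * u) * g u \<partial>lborel) has_vector_derivative
      of_real (a * \<sigma> b) * Q * (\<integral>u. K b (\<sigma> b * u) * (of_real u * g u) \<partial>lborel)
      - of_real (\<sigma>' / \<sigma> b) * (\<integral>u. K b (\<sigma> b * u) * h u \<partial>lborel)) (at b)"
proof -
  define F where "F \<beta> s = (\<integral>u. K \<beta> (s * u) * g u \<partial>lborel)" for \<beta> s
  have K_meas [measurable]: "K \<beta> \<in> borel_measurable borel" for \<beta>
    unfolding K_def by measurable
  have "continuous_on UNIV g"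
    using g has_vector_derivative_continuous continuous_at_imp_continuous_on by blast
  then have g_meas [measurable]: "g \<in> borel_measurable borel"
    by (rule borel_measurable_continuous_onI)
  have \<sigma>_lim: "(\<sigma> \<longlongrightarrow> \<sigma> b) (at b)"
    using DERIV_isCont[OF \<sigma>(1)] by (simp add: isCont_def)
  have bound_at: "\<forall>\<^sub>F x in G. \<forall>u. norm (K (\<beta> x) (s x * u)) \<le> D u"
    if "(s \<longlongrightarrow> \<sigma> b) G" "(\<beta> \<longlongrightarrow> b) G" for s \<beta> :: "real \<Rightarrow> real" and G
    using eventually_compose_filterlim[OF bound tendsto_Pair[OF tendsto_mult[OF tendsto_const that(1)] that(2)]]
    by (simp add: K_def norm_lfm_kernel)
  have "((\<lambda>s. F b s) has_vector_derivative - (\<integral>u. K b (\<sigma> b * u) * h u \<partial>lborel) / of_real (\<sigma> b)) (at (\<sigma> b))"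
    unfolding F_def h_def
  proof (rule has_vector_derivative_integral_dilate[OF _ g _ \<sigma>(2)])
    show "continuous_on UNIV (K b)"
      unfolding K_def by (rule continuous_on_lfm_kernel)
    show "\<forall>\<^sub>F s in nhds (\<sigma> b). \<forall>u. norm (K b (s * u)) \<le> D u"
      by (rule bound_at) (auto intro: filterlim_ident)
  qed (use h Dg Dh in \<open>auto simp: h_def\<close>)
  from vector_diff_chain_at[OF \<sigma>(1)[unfolded has_real_derivative_iff_has_vector_derivative] this]
  have dil: "((\<lambda>b'. F b (\<sigma> b')) has_vector_derivative
      - of_real (\<sigma>' / \<sigma> b) * (\<integral>u. K b (\<sigma> b * u) * h u \<partial>lborel)) (at b)"
    by (simp add: comp_def scaleR_conv_of_real)
  \<comment> \<open>\<open>R\<close> is the difference quotient of the first part under the integral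
    sign; factoring it by the kernel shift isolates \<open>exp (y b' u) - 1\<close>.\<close>
  define y where "y b' u = of_real (a * (b' - b) * (\<sigma> b' * u)) * Q" for b' u
  define R where "R b' u = K b (\<sigma> b' * u) * ((exp (y b' u) - 1) / of_real (b' - b)) * g u" for b' u
  have R_eq: "R b' u = (K b' (\<sigma> b' * u) * g u - K b (\<sigma> b' * u) * g u) / of_real (b' - b)" for b' u
    unfolding R_def y_def K_def lfm_kernel_shift[of \<mu> P Q a b' _ b] by (simp add: algebra_simps diff_divide_distrib)
  have ev_b: "\<forall>\<^sub>F b' in at b. \<forall>u. norm (K b (\<sigma> b' * u)) \<le> D u"
    by (rule bound_at[OF \<sigma>_lim]) simp
  have ev_b': "\<forall>\<^sub>F b' in at b. \<forall>u. norm (K b' (\<sigma> b' * u)) \<le> D u"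
    by (rule bound_at[OF \<sigma>_lim]) simp
  \<comment> \<open>The upper limit is the origin of the factor 2 in the dominating function
    below.\<close>
  have ev_\<sigma>: "\<forall>\<^sub>F b' in at b. \<sigma> b' \<in> {0<..<2 * \<sigma> b}"
    using \<sigma>_lim by (rule topological_tendstoD) (use \<sigma>(2) in auto)
  have ev_ne: "\<forall>\<^sub>F b' in at b. b' \<noteq> b"
    by (simp add: eventually_at_filter)
  have lim: "((\<lambda>b'. \<integral>u. R b' u \<partial>lborel) \<longlongrightarrow>
      (\<integral>u. of_real (a * \<sigma> b) * Q * (K b (\<sigma> b * u) * (of_real u * g u)) \<partial>lborel)) (at b)"
  proof (rule tendsto_integral_at)
    show "R b' \<in> borel_measurable lborel" for b'
      unfolding R_eq[abs_def] by measurable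
    show "integrable lborel (\<lambda>u. 2 * \<bar>a\<bar> * \<sigma> b * norm Q * (D u * norm (of_real u * g u)))"
      using Dg1 by (intro integrable_mult_right)
    show "\<forall>\<^sub>F b' in at b. \<forall>u. norm (R b' u) \<le> 2 * \<bar>a\<bar> * \<sigma> b * norm Q * (D u * norm (of_real u * g u))"
      using ev_b ev_b' ev_\<sigma> ev_ne
    proof eventually_elim
      case (elim b')
      show ?case
      proof
        fix u
        have "norm (R b' u) = norm (K b (\<sigma> b' * u)) * (norm (exp (y b' u) - 1) / \<bar>b' - b\<bar>) * norm (g u)"
          by (simp add: R_def norm_mult norm_divide del: of_real_diff)
        also have "\<dots> \<le> norm (K b (\<sigma> b' * u)) * (norm (y b' u) * max 1 (exp (Re (y b' u))) / \<bar>b' - b\<bar>) * norm (g u)"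
          by (intro mult_right_mono mult_left_mono divide_right_mono norm_exp_minus_one_le) auto
        also have "\<dots> = (norm (y b' u) / \<bar>b' - b\<bar>) * (norm (K b (\<sigma> b' * u)) * max 1 (exp (Re (y b' u)))) * norm (g u)"
          by simp
        \<comment> \<open>The kernel at \<open>b\<close> times \<open>exp (Re (y b' u))\<close> is
          in modulus the kernel at \<open>b'\<close>, so \<open>D\<close> bounds both alternatives
          of the maximum.\<close>
        also have "norm (K b (\<sigma> b' * u)) * max 1 (exp (Re (y b' u))) = max (norm (K b (\<sigma> b' * u))) (norm (K b' (\<sigma> b' * u)))"
          unfolding K_def lfm_kernel_shift[of \<mu> P Q a b' _ b] by (simp add: max_mult_distrib_left norm_mult y_def)
        also have "norm (y b' u) / \<bar>b' - b\<bar> = \<bar>a\<bar> * \<sigma> b' * norm Q * \<bar>u\<bar>"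
          using elim by (simp add: y_def norm_mult abs_mult del: of_real_diff of_real_mult)
        also have "\<bar>a\<bar> * \<sigma> b' * norm Q * \<bar>u\<bar> * max (norm (K b (\<sigma> b' * u))) (norm (K b' (\<sigma> b' * u))) * norm (g u) \<le>
            \<bar>a\<bar> * (2 * \<sigma> b) * norm Q * \<bar>u\<bar> * D u * norm (g u)"
          using elim \<sigma>(2) order_trans[OF norm_ge_zero, of "K b (\<sigma> b' * u)" "D u"]
          by (intro mult_mono mult_nonneg_nonneg) (auto simp: le_max_iff_disj)
        finally show "norm (R b' u) \<le> 2 * \<bar>a\<bar> * \<sigma> b * norm Q * (D u * norm (of_real u * g u))"
          by (simp add: norm_mult mult_ac)
      qed
    qed
    show "((\<lambda>b'. R b' u) \<longlongrightarrow> of_real (a * \<sigma> b) * Q * (K b (\<sigma> b * u) * (of_real u * g u))) (at b)" for u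
    proof -
      have "((\<lambda>b'. a * (b' - b) * (\<sigma> b' * u)) has_real_derivative a * \<sigma> b * u) (at b)"
        using \<sigma>(1) by (auto intro!: derivative_eq_intros)
      then have "((\<lambda>b'. y b' u) has_vector_derivative of_real (a * \<sigma> b * u) * Q) (at b)"
        unfolding y_def
        by (intro has_vector_derivative_mult_left has_vector_derivative_of_real)
      from field_vector_diff_chain_at[OF this DERIV_exp]
      have "((\<lambda>b'. exp (y b' u)) has_vector_derivative of_real (a * \<sigma> b * u) * Q) (at b)"
        by (simp add: comp_def y_def)
      then have "((\<lambda>b'. (exp (y b' u) - 1) / of_real (b' - b)) \<longlongrightarrow> of_real (a * \<sigma> b * u) * Q) (at b)"
        by (simp add: has_vector_derivative_iff_quotient y_def)
      moreover have "isCont (K b) (\<sigma> b * u)"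
        using continuous_on_lfm_kernel by (simp add: K_def continuous_on_eq_continuous_at)
      ultimately have "((\<lambda>b'. R b' u) \<longlongrightarrow> K b (\<sigma> b * u) * (of_real (a * \<sigma> b * u) * Q) * g u) (at b)"
        unfolding R_def using \<sigma>_lim by (intro tendsto_intros isCont_tendsto_compose[of _ "K b"])
      then show ?thesis
        by (simp add: mult_ac)
    qed
  qed measurable
  \<comment> \<open>The vanishing term \<open>F b (\<sigma> b) - F b (\<sigma> b)\<close> is the
    value of the first part at \<open>b\<close>; it is written out so that the expression is
    literally a difference quotient.\<close>
  have ev_R: "\<forall>\<^sub>F b' in at b. (\<integral>u. R b' u \<partial>lborel) = (F b' (\<sigma> b') - F b (\<sigma> b') - (F b (\<sigma> b) - F b (\<sigma> b))) / of_real (b' - b)"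
    using ev_b ev_b'
  proof eventually_elim
    case (elim b')
    have "integrable lborel (\<lambda>u. K \<beta> (\<sigma> b' * u) * g u)" if "\<forall>u. norm (K \<beta> (\<sigma> b' * u)) \<le> D u" for \<beta>
      by (rule Bochner_Integration.integrable_bound[OF Dg])
        (use that in \<open>auto simp: norm_mult intro!: mult_right_mono order_trans[OF _ abs_ge_self]\<close>)
    with elim show ?case
      by (simp add: R_eq[abs_def] F_def)
  qed
  have "((\<lambda>b'. (F b' (\<sigma> b') - F b (\<sigma> b') - (F b (\<sigma> b) - F b (\<sigma> b))) / of_real (b' - b)) \<longlongrightarrow>
      of_real (a * \<sigma> b) * Q * (\<integral>u. K b (\<sigma> b * u) * (of_real u * g u) \<partial>lborel)) (at b)"
    using Lim_transform_eventually[OF lim ev_R] by (simp only: integral_mult_right_zero)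
  then have "((\<lambda>b'. F b' (\<sigma> b') - F b (\<sigma> b')) has_vector_derivative
      of_real (a * \<sigma> b) * Q * (\<integral>u. K b (\<sigma> b * u) * (of_real u * g u) \<partial>lborel)) (at b)"
    by (simp add: has_vector_derivative_iff_quotient)
  from has_vector_derivative_add[OF this dil] show ?thesis
    by (simp add: F_def)
qed

lemma window_has_vector_derivative:
  "window g \<Longrightarrow> (g has_vector_derivative vector_derivative g (at u)) (at u)"
  by (simp add: window_def vector_derivative_works[symmetric])

text \<open>The pair (\<alpha>, \<beta>) corresponds to the scale
  \<open>\<alpha> / \<sigma> \<beta>\<close> at time \<beta>, a map continuous at the base point, so
  existence near (\<open>a\<close>, \<open>b\<close>) gives integrability of the Gaussian moduli.
  Adding the three windows yields one dominator for all of them.\<close>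

lemma lfm_cwt_dominator:
  fixes A p q c r a b \<mu> :: real and \<sigma> :: "real \<Rightarrow> real" and g :: "real \<Rightarrow> complex"
  defines "x \<equiv> lfm_signal A p q c r"
  assumes A: "A \<noteq> 0" and \<sigma>_pos: "\<And>t. \<sigma> t > 0" and \<sigma>_cont: "isCont \<sigma> b" and a: "a > 0"
    and ex: "\<forall>\<^sub>F (a', b') in nhds (a, b). adp_cwt_exists \<mu> \<sigma> g x a' b' \<and>
           adp_cwt_exists \<mu> \<sigma> (win1 g) x a' b' \<and> adp_cwt_exists \<mu> \<sigma> (win2 g) x a' b'"
  obtains D :: "real \<Rightarrow> real" where
    "integrable lborel (\<lambda>u. D u * (norm (g u) + norm (win1 g u) + norm (win2 g u)))"
    "D \<in> borel_measurable borel"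
    "\<forall>\<^sub>F (\<alpha>, \<beta>) in nhds (a * \<sigma> b, b). \<forall>u. exp (q * \<alpha>\<^sup>2 / 2 * u\<^sup>2 + \<alpha> * (p + q * \<beta>) * u) \<le> D u"
proof (rule gaussian_local_dominator)
  show "a * \<sigma> b > 0"
    using a \<sigma>_pos by simp
  have "((\<lambda>z. (fst z / \<sigma> (snd z), snd z)) \<longlongrightarrow>
      (fst (a * \<sigma> b, b) / \<sigma> (snd (a * \<sigma> b, b)), snd (a * \<sigma> b, b))) (nhds (a * \<sigma> b, b))"
    by (intro tendsto_intros isCont_tendsto_compose[of _ \<sigma>] filterlim_ident)
      (use \<sigma>_cont \<sigma>_pos[of b] in auto)
  then have "((\<lambda>z. (fst z / \<sigma> (snd z), snd z)) \<longlongrightarrow> (a, b)) (nhds (a * \<sigma> b, b))"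
    using \<sigma>_pos[of b] by simp
  from eventually_compose_filterlim[OF ex this]
  show "\<forall>\<^sub>F (\<alpha>, \<beta>) in nhds (a * \<sigma> b, b). integrable lborel (\<lambda>u. exp (q * \<alpha>\<^sup>2 / 2 * u\<^sup>2 + \<alpha> * (p + q * \<beta>) * u) *
      (norm (g u) + norm (win1 g u) + norm (win2 g u)))"
  proof eventually_elim
    case (elim z)
    obtain \<alpha> \<beta> where z: "z = (\<alpha>, \<beta>)"
      by (cases z)
    have "integrable lborel (\<lambda>u. exp (q * \<alpha>\<^sup>2 / 2 * u\<^sup>2 + \<alpha> * (p + q * \<beta>) * u) * norm (h u))"
      if "adp_cwt_exists \<mu> \<sigma> h x (\<alpha> / \<sigma> \<beta>) \<beta>" for h
      using that \<sigma>_pos[of \<beta>] A unfolding x_def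
      by (simp add: adp_cwt_exists_lfm_iff) (drule integrable_norm, simp add: norm_mult norm_lfm_kernel)
    with elim show ?case
      unfolding z by (simp add: distrib_left)
  qed
qed

text \<open>The transform is \<open>x b'\<close> times a kernel integral, so the derivative is a
  product rule: \<open>x' = (P + Q t) x\<close> gives the first term, and splitting
  \<open>g + u g'\<close> gives the sum in the last. Both conclusions rest on the same
  dominator.\<close>

lemma
  fixes A p q c r a b \<mu> :: real and \<sigma> :: "real \<Rightarrow> real" and g :: "real \<Rightarrow> complex"
  defines "x \<equiv> lfm_signal A p q c r"
  assumes A: "A \<noteq> 0" and \<sigma>_pos: "\<And>t. \<sigma> t > 0" and \<sigma>: "(\<sigma> has_real_derivative \<sigma>') (at b)" and a: "a > 0"
    and window: "window g"
    and ex: "\<forall>\<^sub>F (a', b') in nhds (a, b). adp_cwt_exists \<mu> \<sigma> g x a' b' \<and>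
           adp_cwt_exists \<mu> \<sigma> (win1 g) x a' b' \<and> adp_cwt_exists \<mu> \<sigma> (win2 g) x a' b'"
  shows isCont_lfm_cwt_scale: "isCont (\<lambda>a'. adp_cwt \<mu> \<sigma> g x a' b) a"
    and has_vector_derivative_lfm_cwt: "((\<lambda>b'. adp_cwt \<mu> \<sigma> g x a b') has_vector_derivative
        (Complex p (2 * pi * c) + Complex q (2 * pi * r) * of_real b) * adp_cwt \<mu> \<sigma> g x a b
        + of_real (a * \<sigma> b) * Complex q (2 * pi * r) * adp_cwt \<mu> \<sigma> (win1 g) x a b
        - of_real (\<sigma>' / \<sigma> b) * (adp_cwt \<mu> \<sigma> g x a b + adp_cwt \<mu> \<sigma> (win2 g) x a b)) (at b)"
proof -
  define P where "P = Complex p (2 * pi * c)"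
  define Q where "Q = Complex q (2 * pi * r)"
  define K where "K = lfm_kernel \<mu> P Q"
  have K_meas [measurable]: "K a' b' \<in> borel_measurable borel" for a' b'
    unfolding K_def by measurable
  have g_meas [measurable]: "g \<in> borel_measurable borel"
    using window by (simp add: window_def)
  have g1_meas [measurable]: "win1 g \<in> borel_measurable borel"
    unfolding win1_def[abs_def] by measurable
  have W: "adp_cwt \<mu> \<sigma> w x a' b' = x b' * (\<integral>u. K a' b' (\<sigma> b' * u) * w u \<partial>lborel)" for w a' b'
    unfolding x_def K_def P_def Q_def using \<sigma>_pos by (rule adp_cwt_lfm)
  have "adp_cwt_exists \<mu> \<sigma> (win2 g) x a b"
    using eventually_nhds_x_imp_x[OF ex] by simp
  then have int2: "integrable lborel (\<lambda>u. K a b (\<sigma> b * u) * win2 g u)"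
    using \<sigma>_pos[of b] A by (simp add: x_def K_def P_def Q_def adp_cwt_exists_lfm_iff)
  then have [measurable]: "(\<lambda>u. K a b (\<sigma> b * u) * win2 g u) \<in> borel_measurable borel"
    using borel_measurable_integrable by force
  \<comment> \<open>Measurability of \<open>win2 g\<close> is recovered from its integrable product
    with the kernel, which vanishes nowhere.\<close>
  have "(\<lambda>u. (K a b (\<sigma> b * u) * win2 g u) / K a b (\<sigma> b * u)) \<in> borel_measurable borel"
    by measurable
  then have g2_meas [measurable]: "win2 g \<in> borel_measurable borel"
    by (simp add: K_def lfm_kernel_nonzero)
  obtain D :: "real \<Rightarrow> real" where
    D: "integrable lborel (\<lambda>u. D u * (norm (g u) + norm (win1 g u) + norm (win2 g u)))"
    and D_meas [measurable]: "D \<in> borel_measurable borel"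
    and bound: "\<forall>\<^sub>F (\<alpha>, \<beta>) in nhds (a * \<sigma> b, b). \<forall>u. exp (q * \<alpha>\<^sup>2 / 2 * u\<^sup>2 + \<alpha> * (p + q * \<beta>) * u) \<le> D u"
    using lfm_cwt_dominator[where g = g, OF A \<sigma>_pos DERIV_isCont[OF \<sigma>] a ex[unfolded x_def]] .
  have D_nonneg: "D u \<ge> 0" for u
    using eventually_nhds_x_imp_x[OF bound] by (auto intro: order_trans[OF less_imp_le[OF exp_gt_zero]])
  have D_int: "integrable lborel (\<lambda>u. D u * norm (w u))"
    if [measurable]: "w \<in> borel_measurable borel" and "\<And>u. norm (w u) \<le> norm (g u) + norm (win1 g u) + norm (win2 g u)"
    for w :: "real \<Rightarrow> complex"
    by (rule Bochner_Integration.integrable_bound[OF D])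
      (use D_nonneg that in \<open>auto simp: abs_mult intro!: mult_left_mono order_trans[OF _ abs_ge_self]\<close>)
  have Dg: "integrable lborel (\<lambda>u. D u * norm (g u))"
    by (rule D_int) auto
  have "((\<lambda>a'. \<integral>u. K a' b (\<sigma> b * u) * g u \<partial>lborel) \<longlongrightarrow> (\<integral>u. K a b (\<sigma> b * u) * g u \<partial>lborel)) (at a)"
  proof (rule tendsto_integral_at[OF _ _ Dg])
    have "((\<lambda>a'. (a' * \<sigma> b, b)) \<longlongrightarrow> (a * \<sigma> b, b)) (at a)"
      by (intro tendsto_intros)
    from eventually_compose_filterlim[OF bound this]
    show "\<forall>\<^sub>F a' in at a. \<forall>u. norm (K a' b (\<sigma> b * u) * g u) \<le> D u * norm (g u)"
    proof eventually_elim
      case (elim a')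
      then have "norm (K a' b (\<sigma> b * u)) \<le> D u" for u
        by (simp add: K_def norm_lfm_kernel P_def Q_def)
      then show ?case
        by (auto simp: norm_mult intro: mult_right_mono)
    qed
    show "((\<lambda>a'. K a' b (\<sigma> b * u) * g u) \<longlongrightarrow> K a b (\<sigma> b * u) * g u) (at a)" for u
      unfolding K_def lfm_kernel_def by (intro tendsto_intros) auto
  qed measurable
  then show "isCont (\<lambda>a'. adp_cwt \<mu> \<sigma> g x a' b) a"
    unfolding isCont_def W by (intro tendsto_intros)
  have "((\<lambda>b'. \<integral>u. K a b' (\<sigma> b' * u) * g u \<partial>lborel) has_vector_derivative
      of_real (a * \<sigma> b) * Q * (\<integral>u. K a b (\<sigma> b * u) * (of_real u * g u) \<partial>lborel)
      - of_real (\<sigma>' / \<sigma> b) * (\<integral>u. K a b (\<sigma> b * u) * (g u + of_real u * vector_derivative g (at u)) \<partial>lborel)) (at b)"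
    unfolding K_def
  proof (rule has_vector_derivative_lfm_integral[OF _ _ \<sigma> \<sigma>_pos])
    show "(g has_vector_derivative vector_derivative g (at u)) (at u)" for u
      using window by (rule window_has_vector_derivative)
    show "\<forall>\<^sub>F (\<alpha>, \<beta>) in nhds (a * \<sigma> b, b).
        \<forall>u. exp (Re Q * \<alpha>\<^sup>2 / 2 * u\<^sup>2 + \<alpha> * (Re P + Re Q * \<beta>) * u) \<le> D u"
      using bound by (simp add: P_def Q_def)
    show "integrable lborel (\<lambda>u. D u * norm (g u))"
      by (rule Dg)
    show "integrable lborel (\<lambda>u. D u * norm (of_real u * g u))"
      by (rule D_int) (auto simp: win1_def)
    show h': "(\<lambda>u. g u + of_real u * vector_derivative g (at u)) \<in> borel_measurable borel"
      using borel_measurable_add[OF g_meas g2_meas] by (simp add: win2_def)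
    show "integrable lborel (\<lambda>u. D u * norm (g u + of_real u * vector_derivative g (at u)))"
      by (rule D_int[OF h']) (simp add: win2_def add_increasing2 norm_triangle_le)
  qed
  also have "(\<integral>u. K a b (\<sigma> b * u) * (of_real u * g u) \<partial>lborel) = (\<integral>u. K a b (\<sigma> b * u) * win1 g u \<partial>lborel)"
    by (simp add: win1_def)
  also have "(\<integral>u. K a b (\<sigma> b * u) * (g u + of_real u * vector_derivative g (at u)) \<partial>lborel) =
      (\<integral>u. K a b (\<sigma> b * u) * g u \<partial>lborel) + (\<integral>u. K a b (\<sigma> b * u) * win2 g u \<partial>lborel)"
  proof -
    have "adp_cwt_exists \<mu> \<sigma> g x a b"
      using eventually_nhds_x_imp_x[OF ex] by simp
    then have "integrable lborel (\<lambda>u. K a b (\<sigma> b * u) * g u)"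
      using \<sigma>_pos[of b] A by (simp add: x_def K_def P_def Q_def adp_cwt_exists_lfm_iff)
    with int2 show ?thesis
      by (simp add: distrib_left win2_def)
  qed
  finally have I: "((\<lambda>b'. \<integral>u. K a b' (\<sigma> b' * u) * g u \<partial>lborel) has_vector_derivative
      of_real (a * \<sigma> b) * Q * (\<integral>u. K a b (\<sigma> b * u) * win1 g u \<partial>lborel)
      - of_real (\<sigma>' / \<sigma> b) * ((\<integral>u. K a b (\<sigma> b * u) * g u \<partial>lborel) + (\<integral>u. K a b (\<sigma> b * u) * win2 g u \<partial>lborel))) (at b)" .
  have "(x has_vector_derivative (P + Q * of_real b) * x b) (at b)"
    unfolding x_def P_def Q_def by (rule has_vector_derivative_lfm_signal)
  from has_vector_derivative_mult[OF this I]
  show "((\<lambda>b'. adp_cwt \<mu> \<sigma> g x a b') has_vector_derivative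
        (Complex p (2 * pi * c) + Complex q (2 * pi * r) * of_real b) * adp_cwt \<mu> \<sigma> g x a b
        + of_real (a * \<sigma> b) * Complex q (2 * pi * r) * adp_cwt \<mu> \<sigma> (win1 g) x a b
        - of_real (\<sigma>' / \<sigma> b) * (adp_cwt \<mu> \<sigma> g x a b + adp_cwt \<mu> \<sigma> (win2 g) x a b)) (at b)"
    unfolding W P_def[symmetric] Q_def[symmetric]
    by (rule has_vector_derivative_eq_rhs) (simp only: algebra_simps)
qed

section \<open>The phase transformation of an LFM signal\<close>

theorem theorem1:
  fixes \<mu> A p q c r a b :: real
    and \<sigma> :: "real \<Rightarrow> real"
    and g x :: "real \<Rightarrow> complex"
  assumes mu_pos: "\<mu> > 0"
    and c_pos: "c > 0"
    and sigma_pos: "\<And>t. \<sigma> t > 0"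
    and sigma_diff: "\<And>t. \<sigma> differentiable (at t)"
    and window: "window g"
    and signal: "x = lfm_signal A p q c r"
    and a_pos: "a > 0"
    and cwt_exists: "\<forall>\<^sub>F (a', b') in nhds (a, b).
           adp_cwt_exists \<mu> \<sigma> g x a' b' \<and>
           adp_cwt_exists \<mu> \<sigma> (win1 g) x a' b' \<and>
           adp_cwt_exists \<mu> \<sigma> (win2 g) x a' b'"
    and diff_a_ratio1: "(\<lambda>a'. complex_of_real a' * ratio1 \<mu> \<sigma> g x a' b) differentiable (at a)"
    and diff_a_ratio2: "(\<lambda>a'. ratio2 \<mu> \<sigma> g x a' b) differentiable (at a)"
    and R0_denom_nz: "R0_denom \<mu> \<sigma> g x a b \<noteq> 0"
    and cwt_nz: "adp_cwt \<mu> \<sigma> g x a b \<noteq> 0"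
  shows "omega_2adp \<mu> \<sigma> g x a b = deriv (lfm_phase c r) b \<and>
         deriv (lfm_phase c r) b = c + r * b"
proof
  show IF: "deriv (lfm_phase c r) b = c + r * b"
    unfolding lfm_phase_def[abs_def] by (rule DERIV_imp_deriv) (auto intro!: derivative_eq_intros)
  define P where "P = Complex p (2 * pi * c)"
  define Q where "Q = Complex q (2 * pi * r)"
  define W where "W a' = adp_cwt \<mu> \<sigma> g x a' b" for a'
  define W1 where "W1 a' = adp_cwt \<mu> \<sigma> (win1 g) x a' b" for a'
  define W2 where "W2 a' = adp_cwt \<mu> \<sigma> (win2 g) x a' b" for a'
  define l where "l = deriv \<sigma> b / \<sigma> b"
  have A: "A \<noteq> 0"
  proof
    assume "A = 0"
    then have "adp_cwt \<mu> \<sigma> g x a b = 0"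
      using sigma_pos[of b] by (simp add: signal adp_cwt_lfm lfm_signal_eq_0_iff)
    with cwt_nz show False ..
  qed
  have \<sigma>: "(\<sigma> has_real_derivative deriv \<sigma> b) (at b)"
    using sigma_diff DERIV_deriv_iff_real_differentiable by blast
  \<comment> \<open>The formula for \<open>ratio_db\<close> is to be differentiated in
    \<open>a\<close>, so it must hold at every scale near \<open>a\<close>. The neighbourhood
    hypothesis at (\<open>a\<close>, \<open>b\<close>) therefore has to hold at (\<open>a'\<close>,
    \<open>b\<close>) too.\<close>
  have "((\<lambda>a'. (a', b)) \<longlongrightarrow> (a, b)) (nhds a)"
    by (intro tendsto_Pair filterlim_ident tendsto_const)
  then have "\<forall>\<^sub>F a' in nhds a. \<forall>\<^sub>F (a', b') in nhds (a', b). adp_cwt_exists \<mu> \<sigma> g x a' b' \<and>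
      adp_cwt_exists \<mu> \<sigma> (win1 g) x a' b' \<and> adp_cwt_exists \<mu> \<sigma> (win2 g) x a' b'"
    using cwt_exists by (intro eventually_compose_filterlim[where f = "\<lambda>a'. (a', b)"]) (simp_all add: eventually_eventually)
  moreover have "\<forall>\<^sub>F a' in nhds a. a' > 0"
    using eventually_nhds_in_open[of "{0<..}" a] a_pos by simp
  moreover have "\<forall>\<^sub>F a' in nhds a. W a' \<noteq> 0"
  proof (rule tendsto_imp_eventually_ne)
    have "isCont W a"
      unfolding W_def signal
      by (rule isCont_lfm_cwt_scale[OF A sigma_pos \<sigma> a_pos window cwt_exists[unfolded signal]])
    then show "(W \<longlongrightarrow> W a) (nhds a)"
      by (simp add: isCont_def tendsto_at_iff_tendsto_nhds)
  qed (use cwt_nz in \<open>simp add: W_def\<close>)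
  ultimately have ratio_db_eq: "\<forall>\<^sub>F a' in nhds a. ratio_db \<mu> \<sigma> g x a' b =
      P + Q * of_real b - of_real l + of_real (\<sigma> b) * Q * (of_real a' * ratio1 \<mu> \<sigma> g x a' b) - of_real l * ratio2 \<mu> \<sigma> g x a' b"
  proof eventually_elim
    case (elim a')
    have db: "adp_cwt_db \<mu> \<sigma> g x a' b = (P + Q * of_real b) * W a' + of_real (a' * \<sigma> b) * Q * W1 a' - of_real l * (W a' + W2 a')"
      unfolding adp_cwt_db_def W_def W1_def W2_def l_def P_def Q_def signal
      by (rule vector_derivative_at)
        (rule has_vector_derivative_lfm_cwt[OF A sigma_pos \<sigma> elim(2) window elim(1)[unfolded signal]])
    show ?case
      unfolding ratio_db_def db ratio1_def ratio2_def W_def[symmetric] W1_def[symmetric] W2_def[symmetric]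
      using elim(3) by (simp add: field_simps)
  qed
  have "((\<lambda>a'. of_real a' * ratio1 \<mu> \<sigma> g x a' b) has_vector_derivative R0_denom \<mu> \<sigma> g x a b) (at a)"
    using diff_a_ratio1 unfolding R0_denom_def by (simp add: vector_derivative_works[symmetric])
  moreover have "((\<lambda>a'. ratio2 \<mu> \<sigma> g x a' b) has_vector_derivative
      vector_derivative (\<lambda>a'. ratio2 \<mu> \<sigma> g x a' b) (at a)) (at a)"
    using diff_a_ratio2 by (simp add: vector_derivative_works[symmetric])
  ultimately have "((\<lambda>a'. P + Q * of_real b - of_real l + of_real (\<sigma> b) * Q * (of_real a' * ratio1 \<mu> \<sigma> g x a' b)
      - of_real l * ratio2 \<mu> \<sigma> g x a' b) has_vector_derivative
      0 + of_real (\<sigma> b) * Q * R0_denom \<mu> \<sigma> g x a b - of_real l * vector_derivative (\<lambda>a'. ratio2 \<mu> \<sigma> g x a' b) (at a)) (at a)"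
    by (intro has_vector_derivative_diff has_vector_derivative_add has_vector_derivative_const has_vector_derivative_mult_right)
  \<comment> \<open>Differentiability of \<open>ratio_db\<close> in \<open>a\<close> comes from the
    formula, so its \<open>vector_derivative\<close> in \<open>R0\<close> is a genuine value and not
    the default one. Only the two assumed derivatives of ratios enter.\<close>
  from iffD2[OF has_vector_derivative_cong_ev this]
  have "((\<lambda>a'. ratio_db \<mu> \<sigma> g x a' b) has_vector_derivative
      of_real (\<sigma> b) * Q * R0_denom \<mu> \<sigma> g x a b - of_real l * vector_derivative (\<lambda>a'. ratio2 \<mu> \<sigma> g x a' b) (at a)) (at a)"
    using ratio_db_eq eventually_nhds_x_imp_x[OF ratio_db_eq]
    by simp
  then have R0: "R0 \<mu> \<sigma> g x a b = of_real (\<sigma> b) * Q"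
    using R0_denom_nz unfolding R0_def l_def[symmetric] by (simp add: vector_derivative_at)
  have "omega_2adp \<mu> \<sigma> g x a b = Re (ratio_db \<mu> \<sigma> g x a b / (\<i> * 2 * pi))
      + l * Re (ratio2 \<mu> \<sigma> g x a b / (\<i> * 2 * pi))
      - a * Re (ratio1 \<mu> \<sigma> g x a b / (\<i> * 2 * pi) * (of_real (\<sigma> b) * Q))"
    using cwt_nz R0_denom_nz unfolding omega_2adp_def R0 ratio_db_def ratio1_def ratio2_def l_def
    by (simp add: mult.commute)
  also have "\<dots> = Re ((ratio_db \<mu> \<sigma> g x a b + of_real l * ratio2 \<mu> \<sigma> g x a b
      - of_real a * ratio1 \<mu> \<sigma> g x a b * (of_real (\<sigma> b) * Q)) / (\<i> * 2 * pi))"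
  proof -
    have "l * Re z = Re (of_real l * z)" "a * Re z = Re (of_real a * z)" for z
      by simp_all
    then show ?thesis
      by (simp only: plus_complex.sel(1)[symmetric] minus_complex.sel(1)[symmetric]
          add_divide_distrib diff_divide_distrib times_divide_eq_left times_divide_eq_right mult.assoc)
  qed
  \<comment> \<open>Inserting the formula for \<open>ratio_db\<close> cancels both window ratios
    exactly.\<close>
  also have "\<dots> = Re ((P + Q * of_real b - of_real l) / (\<i> * 2 * pi))"
    unfolding eventually_nhds_x_imp_x[OF ratio_db_eq] by (simp add: algebra_simps)
  \<comment> \<open>The real quantities \<open>p\<close>, \<open>q * b\<close> and \<open>l\<close>
    become purely imaginary on division by \<open>\<i> * 2 * pi\<close>; only the imaginary parts of
    \<open>P\<close> and \<open>Q\<close> survive.\<close>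
  also have "\<dots> = c + r * b"
    by (simp add: P_def Q_def Re_divide field_simps power2_eq_square)
  finally show "omega_2adp \<mu> \<sigma> g x a b = deriv (lfm_phase c r) b"
    by (simp add: IF)
qed

end
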